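(* Let $X_1, X_2, \ldots$ be independent and identically distributed real-valued random variables on a probability space with probability measure $\mathbf{P}$, with finite mean (that is, $\mathbf{E}|X_1| < \infty$). For each $n \in \mathbf{N} = \{1,2,3,\ldots\}$, let $S_n := X_1 + \cdots + X_n$. If $\mathbf{E}[X_1] > 0$, then $\mathbf{P}(S_n > 0 \text{ for all } n \in \mathbf{N}) > 0$.
   Context: $\mathbf{N}$ denotes the set of positive integers, $\mathbf{P}$ the probability measure, and $\mathbf{E}$ the expectation with respect to $\mathbf{P}$. *)

theory Defs
  imports "HOL-Probability.Probability"
begin

end

theory Submission
  imports Defs
begin

text \<open>
  Let \<open>m\<^sub>N\<close> be the minimum of \<open>0, S\<^sub>1, \<dots>, S\<^sub>N\<close> and \<open>m'\<^sub>N\<close> the same quantity for the shifted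
  sequence \<open>X\<^sub>2, X\<^sub>3, \<dots>\<close>. Then \<open>m\<^bsub>N+1\<^esub> = min 0 (X\<^sub>1 + m'\<^sub>N) = X\<^sub>1 + m'\<^sub>N - W\<^sub>N\<close> with
  \<open>W\<^sub>N = max 0 (X\<^sub>1 + m'\<^sub>N)\<close>, so by stationarity \<open>E m\<^bsub>N+1\<^esub> = E m\<^sub>N + E X\<^sub>1 - E W\<^sub>N\<close>.
  Since \<open>0 \<le> W\<^sub>N \<le> |X\<^sub>1|\<close> and \<open>W\<^sub>N\<close> vanishes as soon as \<open>S\<^sub>n \<le> 0\<close> for some \<open>n \<le> N + 1\<close>, if almost
  surely some \<open>S\<^sub>n\<close> were nonpositive then dominated convergence would give \<open>E W\<^sub>N \<rightarrow> 0\<close>, whence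
  \<open>E m\<^sub>N\<close> would grow linearly, contradicting \<open>m\<^sub>N \<le> 0\<close>.
\<close>

text \<open>The empty sum is included, which forces the value to be nonpositive. As a functional of
  a whole sequence, its expectation along random variables depends only on their joint law.\<close>

primrec min_partial_sum :: "nat \<Rightarrow> (nat \<Rightarrow> real) \<Rightarrow> real" where
  "min_partial_sum 0 x = 0"
| "min_partial_sum (Suc N) x = min (min_partial_sum N x) (\<Sum>i\<le>N. x i)"

text \<open>Every nonempty partial sum contains \<open>x 0\<close>; factoring it out leaves the
  partial sums of the shifted sequence, the empty one included.\<close>

lemma min_partial_sum_Suc_shift:
  "min_partial_sum (Suc N) x = min 0 (x 0 + min_partial_sum N (\<lambda>i. x (Suc i)))"
proof (induction N)
  case (Suc N)
  have "min_partial_sum (Suc (Suc N)) x =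
      min (min_partial_sum (Suc N) x) (x 0 + (\<Sum>i\<le>N. x (Suc i)))"
    by (simp only: min_partial_sum.simps sum.atMost_Suc_shift)
  then show ?case
    unfolding Suc.IH by (simp add: min_def)
qed simp

lemma min_partial_sum_nonpos: "min_partial_sum N x \<le> 0"
  by (induction N) auto

lemma min_partial_sum_le_sum: "n \<le> N \<Longrightarrow> min_partial_sum N x \<le> sum x {..<n}"
  by (induction N) (auto simp: le_Suc_eq lessThan_Suc_atMost)

lemma measurable_min_partial_sum [measurable]:
  assumes [measurable]: "\<And>i. X i \<in> borel_measurable M"
  shows "(\<lambda>\<omega>. min_partial_sum N (\<lambda>i. X i \<omega>)) \<in> borel_measurable M"
  by (induction N) auto

lemma integrable_min_partial_sum:
  assumes [simp]: "\<And>i. integrable M (X i)"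
  shows "integrable M (\<lambda>\<omega>. min_partial_sum N (\<lambda>i. X i \<omega>))"
  by (induction N) auto

text \<open>The joint law over \<open>I\<close> is a product of copies of \<open>D\<close>, and
  reading distinct coordinates of it along an injection again gives such a product.\<close>

lemma (in prob_space) distr_iid_subsequence:
  assumes indep: "indep_vars (\<lambda>_. N) X I"
    and ident: "\<And>i. i \<in> I \<Longrightarrow> distr M N (X i) = D"
    and f: "inj f" "range f \<subseteq> I"
  shows "distr M (PiM UNIV (\<lambda>_. N)) (\<lambda>\<omega> n. X (f n) \<omega>) = PiM UNIV (\<lambda>_. D)"
proof -
  have rv [measurable]: "X i \<in> measurable M N" if "i \<in> I" for i
    using indep that by (auto simp: indep_vars_def2)
  obtain i where "i \<in> I" using f by auto
  then have D: "prob_space D" "sets D = sets N"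
    using prob_space_distr[OF rv] ident by fastforce+
  have joint: "distr M (PiM I (\<lambda>_. N)) (\<lambda>\<omega>. \<lambda>i\<in>I. X i \<omega>) = PiM I (\<lambda>_. D)"
    using indep_vars_iff_distr_eq_PiM'[where I = I and M' = "\<lambda>_. N" and X = X] indep rv ident \<open>i \<in> I\<close>
    by (auto cong: PiM_cong)
  have eq: "PiM UNIV (\<lambda>_. D) = distr (PiM I (\<lambda>_. D)) (PiM UNIV (\<lambda>_. N)) (\<lambda>x n. x (f n))"
    using distr_PiM_reindex[of I "\<lambda>_. D" f UNIV] f D
    by (auto simp: Pi_iff image_subset_iff restrict_UNIV cong: distr_cong sets_PiM_cong)
  have fI: "f n \<in> I" for n using f by auto
  have [measurable]: "(\<lambda>\<omega>. \<lambda>i\<in>I. X i \<omega>) \<in> measurable M (PiM I (\<lambda>_. N))"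
    by (intro measurable_restrict) auto
  have [measurable]: "(\<lambda>x n. x (f n)) \<in> measurable (PiM I (\<lambda>_. N)) (PiM UNIV (\<lambda>_. N))"
    using fI by (intro measurable_PiM_single')
      (auto simp: space_PiM intro: measurable_component_singleton)
  show ?thesis
    unfolding eq joint[symmetric] using fI by (subst distr_distr) (auto simp: o_def)
qed

text \<open>The right-hand side is free of \<open>f\<close>, so \<open>Suc\<close> and its double
  iterate yield the same expectation: this is the stationarity used below.\<close>

lemma (in prob_space) expectation_min_partial_sum_iid:
  fixes X :: "'b \<Rightarrow> 'a \<Rightarrow> real"
  assumes indep: "indep_vars (\<lambda>_. borel) X I"
    and ident: "\<And>i. i \<in> I \<Longrightarrow> distr M borel (X i) = D"
    and f: "inj f" "range f \<subseteq> I"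
  shows "expectation (\<lambda>\<omega>. min_partial_sum N (\<lambda>n. X (f n) \<omega>)) =
    (\<integral>x. min_partial_sum N x \<partial>PiM UNIV (\<lambda>_. D))"
proof -
  have [measurable]: "X (f n) \<in> borel_measurable M" for n
    using indep f by (auto simp: indep_vars_def2)
  have "(\<lambda>\<omega> n. X (f n) \<omega>) \<in> measurable M (PiM UNIV (\<lambda>_. borel))"
    by (intro measurable_PiM_single') auto
  moreover have "min_partial_sum N \<in> borel_measurable (PiM UNIV (\<lambda>_. borel))"
    using measurable_min_partial_sum[of "\<lambda>i x. x i" "PiM UNIV (\<lambda>_. borel)" N] by simp
  ultimately show ?thesis
    by (simp add: integral_distr flip: distr_iid_subsequence[OF assms])
qed

theorem theorem1:
  fixes M :: "'a measure" and X :: "nat \<Rightarrow> 'a \<Rightarrow> real"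
  assumes "prob_space M"
    and indep: "prob_space.indep_vars M (\<lambda>_. borel) X {1..}"
    and ident: "\<And>i. i \<ge> 1 \<Longrightarrow> distr M borel (X i) = distr M borel (X 1)"
    and finite_mean: "integrable M (X 1)"
    and pos_mean: "(\<integral>\<omega>. X 1 \<omega> \<partial>M) > 0"
  shows "measure M {\<omega> \<in> space M. \<forall>n\<ge>1. (\<Sum>i=1..n. X i \<omega>) > 0} > 0"
proof (rule ccontr)
  interpret prob_space M by fact
  have rv: "X i \<in> borel_measurable M" if "i \<ge> 1" for i
    using indep that by (auto simp: indep_vars_def2)
  have rv_Suc [measurable]: "X (Suc i) \<in> borel_measurable M" for i
    by (simp add: rv)
  have int: "integrable M (X (Suc i))" for i
  proof -
    have "integrable (distr M borel (X 1)) (\<lambda>x. x)"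
      using finite_mean by (subst integrable_distr_eq) (auto simp: rv)
    then have "integrable (distr M borel (X (Suc i))) (\<lambda>x. x)"
      by (subst ident) auto
    then show ?thesis
      by (subst (asm) integrable_distr_eq) auto
  qed
  \<comment> \<open>Indexing through \<open>Suc\<close> matches sequences starting at 0 and shows
    only measurable variables; \<open>X 0\<close> is arbitrary.\<close>
  have shift_sum: "(\<Sum>i=1..n. X i \<omega>) = (\<Sum>i<n. X (Suc i) \<omega>)" for n \<omega>
    by (rule sum.reindex_bij_witness[of _ Suc "\<lambda>i. i - 1"]) auto
  define \<mu> where "\<mu> = expectation (X 1)"
  define m where "m N \<omega> = min_partial_sum N (\<lambda>i. X (Suc i) \<omega>)" for N \<omega>
  define m' where "m' N \<omega> = min_partial_sum N (\<lambda>i. X (Suc (Suc i)) \<omega>)" for N \<omega>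
  define W where "W N \<omega> = max 0 (X 1 \<omega> + m' N \<omega>)" for N \<omega>
  have int_m: "integrable M (m N)" "integrable M (m' N)" for N
    unfolding m_def m'_def by (intro integrable_min_partial_sum int)+
  then have int_W: "integrable M (W N)" for N
    unfolding W_def using finite_mean by simp
  have ident': "distr M borel (X i) = distr M borel (X 1)" if "i \<in> {1..}" for i
    using that by (intro ident) simp
  have stationary: "expectation (m' N) = expectation (m N)" for N
  proof -
    note E = expectation_min_partial_sum_iid[OF indep ident', where N = N]
    have "inj Suc" "range Suc \<subseteq> {1..}"
      and "inj (\<lambda>i. Suc (Suc i))" "range (\<lambda>i. Suc (Suc i)) \<subseteq> {1..}"
      by (auto intro: injI)
    then show ?thesis
      unfolding m_def m'_def by (simp only: E)
  qed
  have rec: "expectation (m (Suc N)) = expectation (m N) + \<mu> - expectation (W N)" for N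
  proof -
    have "m (Suc N) = (\<lambda>\<omega>. X 1 \<omega> + m' N \<omega> - W N \<omega>)"
      unfolding m_def m'_def W_def min_partial_sum_Suc_shift by (auto simp: fun_eq_iff)
    then show ?thesis
      using finite_mean int_m int_W by (simp add: stationary \<mu>_def)
  qed
  have W_zero: "W N \<omega> = 0" if "n \<ge> 1" "(\<Sum>i=1..n. X i \<omega>) \<le> 0" "N \<ge> n" for n N \<omega>
  proof -
    obtain k where k: "n = Suc k" using \<open>n \<ge> 1\<close> by (cases n) auto
    \<comment> \<open>Adding \<open>X 1 \<omega>\<close> to both sides bounds the argument of the
      maximum in \<open>W\<close> by the nonpositive sum of length \<open>n\<close>.\<close>
    have "m' N \<omega> \<le> (\<Sum>i<k. X (Suc (Suc i)) \<omega>)"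
      unfolding m'_def using k \<open>N \<ge> n\<close> by (intro min_partial_sum_le_sum) auto
    moreover have "(\<Sum>i=1..n. X i \<omega>) = X 1 \<omega> + (\<Sum>i<k. X (Suc (Suc i)) \<omega>)"
      unfolding shift_sum k by (subst sum.lessThan_Suc_shift) simp
    ultimately show ?thesis using that by (simp add: W_def)
  qed
  let ?A = "{\<omega> \<in> space M. \<forall>n\<ge>1. (\<Sum>i=1..n. X i \<omega>) > 0}"
  assume "\<not> prob ?A > 0"
  then have "prob ?A = 0"
    using measure_nonneg[of M ?A] by linarith
  moreover have "?A \<in> events"
    unfolding shift_sum by measurable
  ultimately have "AE \<omega> in M. \<omega> \<notin> ?A"
    by (simp only: prob_eq_0)
  with AE_space have "AE \<omega> in M. (\<lambda>N. W N \<omega>) \<longlonglongrightarrow> 0"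
  proof eventually_elim
    case (elim \<omega>)
    then obtain n where "n \<ge> 1" "(\<Sum>i=1..n. X i \<omega>) \<le> 0"
      unfolding mem_Collect_eq not_less[symmetric] by blast
    then show ?case
      by (intro tendsto_eventually eventually_sequentiallyI[of n]) (rule W_zero)
  qed
  moreover have "norm (W N \<omega>) \<le> norm (X 1 \<omega>)" for N \<omega>
    using min_partial_sum_nonpos[of N "\<lambda>i. X (Suc (Suc i)) \<omega>"] by (simp add: W_def m'_def)
  ultimately have "(\<lambda>N. expectation (W N)) \<longlonglongrightarrow> expectation (\<lambda>_. 0)"
    using finite_mean int_W
    by (intro integral_dominated_convergence[where w = "\<lambda>\<omega>. norm (X 1 \<omega>)"]) auto
  \<comment> \<open>By \<open>rec\<close>, each step from such an \<open>N\<close> on raises the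
    expectation of \<open>m N\<close> by more than \<open>\<mu> / 2\<close>.\<close>
  then have "eventually (\<lambda>N. expectation (W N) < \<mu> / 2) sequentially"
    using pos_mean by (intro order_tendstoD) (auto simp: \<mu>_def)
  then obtain K where K: "\<And>N. N \<ge> K \<Longrightarrow> expectation (W N) < \<mu> / 2"
    by (auto simp: eventually_sequentially)
  have growth: "expectation (m (K + j)) \<ge> expectation (m K) + real j * (\<mu> / 2)" for j
  proof (induction j)
    case (Suc j)
    then show ?case using rec[of "K + j"] K[of "K + j"] by (simp add: field_simps)
  qed simp
  obtain j where "real j * (\<mu> / 2) > - expectation (m K)"
    using reals_Archimedean3[of "\<mu> / 2"] pos_mean unfolding \<mu>_def by (meson half_gt_zero)
  moreover have "m (K + j) \<omega> \<le> 0" for \<omega>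
    by (simp add: m_def min_partial_sum_nonpos)
  then have "expectation (m (K + j)) \<le> 0"
    using integral_nonneg_AE[of "\<lambda>\<omega>. - m (K + j) \<omega>" M] by simp
  ultimately show False using growth[of j] by linarith
qed

end
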